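(* Let $d\ge 1$ and let $\mathfrak{D}_1,\dots,\mathfrak{D}_d$ be shift-invariant linear operators on $\mathbb{R}[x_1,\dots,x_d]$ with indicators $f_1,\dots,f_d\in\mathbb{R}[[x_1,\dots,x_d]]$, where $f_i(\mathbf{x})=\sum_{\mathbf{n}\in\mathbb{N}^d}a^{(i)}_{\mathbf{n}}\mathbf{x}^{\mathbf{n}}$. Let $J_f=(m_{i,j})_{1\le i,j\le d}$ be the $d\times d$ real matrix where $m_{i,j}$ is the constant term of the formal power series $\partial f_i/\partial x_j$. Then $(\mathfrak{D}_1,\dots,\mathfrak{D}_d)$ is a system of delta operators if and only if $\det J_f\neq 0$ and $a^{(i)}_{\mathbf{0}}=0$ for all $i=1,\dots,d$.
   Context: For $\mathbf{v}\in\mathbb{R}^d$, the shift operator $\mathfrak{E}_{\mathbf{v}}$ on $\mathbb{R}[\mathbf{x}]=\mathbb{R}[x_1,\dots,x_d]$ is $f(\mathbf{x})\mapsto f(\mathbf{x}+\mathbf{v})$. A linear operator $\mathfrak{L}$ on $\mathbb{R}[\mathbf{x}]$ is shift-invariant if $\mathfrak{L}\mathfrak{E}_{\mathbf{v}}=\mathfrak{E}_{\mathbf{v}}\mathfrak{L}$ for all $\mathbf{v}\in\mathbb{R}^d$. Every shift-invariant linear operator can be written uniquely as $\mathfrak{L}=\sum_{\mathbf{n}\in\mathbb{N}^d}a_{\mathbf{n}}D_1^{n_1}\cdots D_d^{n_d}$, where $D_i=\partial/\partial x_i$; the formal power series $f(\mathbf{x})=\sum_{\mathbf{n}}a_{\mathbf{n}}\mathbf{x}^{\mathbf{n}}$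 is called the indicator of $\mathfrak{L}$ (here $\mathbf{x}^{\mathbf{n}}=x_1^{n_1}\cdots x_d^{n_d}$). A $d$-tuple $(\mathfrak{D}_1,\dots,\mathfrak{D}_d)$ of shift-invariant linear operators is a system of delta operators if for every nonzero linear polynomial $p(\mathbf{x})=a_1x_1+\cdots+a_dx_d$ one has $\mathfrak{D}_i p=c_i$ for each $i$, where each $c_i$ is a real constant, and at least one of $c_1,\dots,c_d$ is nonzero. *)

theory Defs
  imports "HOL-Analysis.Determinants" "HOL-Analysis.Finite_Function_Topology"
begin

text \<open>
  The polynomial ring in the variables \<open>x\<^sub>i\<close>, \<open>i :: 'n\<close>, with \<open>d = CARD('n)\<close>, is represented by
  finitely supported coefficient functions on the exponent vectors \<open>'n \<Rightarrow>\<^sub>0 nat\<close>; its ring and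
  vector space structures are the library's. Since \<open>'n\<close> is finite, \<open>'n \<Rightarrow>\<^sub>0 nat\<close> contains every
  exponent vector. A formal power series is an arbitrary coefficient function.
\<close>

type_synonym 'n rpoly = "('n \<Rightarrow>\<^sub>0 nat) \<Rightarrow>\<^sub>0 real"
type_synonym 'n rfps = "('n \<Rightarrow>\<^sub>0 nat) \<Rightarrow> real"

definition Const :: "real \<Rightarrow> 'n rpoly" where
  "Const c = Poly_Mapping.single 0 c"

definition Var :: "'n \<Rightarrow> 'n rpoly" where
  "Var i = Poly_Mapping.single (Poly_Mapping.single i 1) 1"

definition poly_subst :: "('n \<Rightarrow> 'n rpoly) \<Rightarrow> ('n::finite) rpoly \<Rightarrow> 'n rpoly" where
  "poly_subst g p =
    (\<Sum>m\<in>Poly_Mapping.keys p. Const (Poly_Mapping.lookup p m) * (\<Prod>i\<in>UNIV. g i ^ Poly_Mapping.lookup m i))"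

definition shift :: "real ^ 'n \<Rightarrow> ('n::finite) rpoly \<Rightarrow> 'n rpoly" where
  "shift v = poly_subst (\<lambda>i. Var i + Const (v $ i))"

definition shift_invariant :: "(('n::finite) rpoly \<Rightarrow> 'n rpoly) \<Rightarrow> bool" where
  "shift_invariant L \<longleftrightarrow> linear L \<and> (\<forall>v. L \<circ> shift v = shift v \<circ> L)"

text \<open>
  In \<open>partial_deriv\<close>, the truncated subtraction on exponents only matters when the exponent of
  \<open>x\<^sub>i\<close> is \<open>0\<close>, and then the coefficient vanishes.
\<close>

definition partial_deriv :: "'n \<Rightarrow> 'n rpoly \<Rightarrow> 'n rpoly" where
  "partial_deriv i p =
    (\<Sum>m\<in>Poly_Mapping.keys p.
      Poly_Mapping.single (m - Poly_Mapping.single i 1)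
        (of_nat (Poly_Mapping.lookup m i) * Poly_Mapping.lookup p m))"

text \<open>
  The operator \<open>(D\<^sub>1)^(n\<^sub>1) \<cdots> (D\<^sub>d)^(n\<^sub>d)\<close>. The order of composition is immaterial because partial
  derivatives commute; see \<open>partial_deriv_fold_commute\<close>.
\<close>

definition partial_derivs :: "('n \<Rightarrow>\<^sub>0 nat) \<Rightarrow> ('n::finite) rpoly \<Rightarrow> 'n rpoly" where
  "partial_derivs n p =
    Finite_Set.fold (\<lambda>i. partial_deriv i ^^ Poly_Mapping.lookup n i) p UNIV"

text \<open>
  \<open>L = (\<Sum>n. a n D\<^sup>n)\<close>, where for every polynomial only finitely many terms of the sum are nonzero;
  see \<open>finite_partial_derivs\<close>.
\<close>

definition has_indicator :: "(('n::finite) rpoly \<Rightarrow> 'n rpoly) \<Rightarrow> 'n rfps \<Rightarrow> bool" where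
  "has_indicator L a \<longleftrightarrow> (\<forall>p. L p = Sum_any (\<lambda>n. a n *\<^sub>R partial_derivs n p))"

text \<open>Meaningful for shift-invariant operators only; see \<open>ex1_has_indicator\<close>.\<close>

definition indicator_fps :: "(('n::finite) rpoly \<Rightarrow> 'n rpoly) \<Rightarrow> 'n rfps" where
  "indicator_fps L = (THE a. has_indicator L a)"

definition rfps_deriv :: "'n \<Rightarrow> 'n rfps \<Rightarrow> 'n rfps" where
  "rfps_deriv j f = (\<lambda>n. of_nat (Poly_Mapping.lookup n j + 1) * f (n + Poly_Mapping.single j 1))"

definition rfps_const_term :: "'n rfps \<Rightarrow> real" where
  "rfps_const_term f = f 0"

definition jacobian_at_0 :: "('n \<Rightarrow> 'n rfps) \<Rightarrow> real ^ 'n ^ ('n::finite)" where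
  "jacobian_at_0 f = (\<chi> i j. rfps_const_term (rfps_deriv j (f i)))"

definition delta_system :: "('n \<Rightarrow> ('n::finite) rpoly \<Rightarrow> 'n rpoly) \<Rightarrow> bool" where
  "delta_system D \<longleftrightarrow>
    (\<forall>i. shift_invariant (D i)) \<and>
    (\<forall>a :: real ^ 'n. (\<Sum>j\<in>UNIV. (a $ j) *\<^sub>R Var j) \<noteq> 0 \<longrightarrow>
      (\<exists>c :: real ^ 'n. (\<forall>i. D i (\<Sum>j\<in>UNIV. (a $ j) *\<^sub>R Var j) = Const (c $ i)) \<and> (\<exists>i. c $ i \<noteq> 0)))"

text \<open>
  Well-definedness of the indicator: the monomial differential operators do not depend on the
  order of composition, the expansion is a finite sum on every polynomial, and every
  shift-invariant operator has exactly one indicator.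
\<close>

context
begin

private abbreviation (input) "lk \<equiv> Poly_Mapping.lookup"
private abbreviation (input) "sg \<equiv> Poly_Mapping.single"

lemma lookup_scaleR_rpoly: "Poly_Mapping.lookup (c *\<^sub>R (p::'n rpoly)) n = c * Poly_Mapping.lookup p n"
proof -
  have "finite {i. c * Poly_Mapping.lookup p i \<noteq> 0}"
    by (rule finite_subset[OF _ finite_lookup[of p]]) auto
  then show ?thesis
    by (simp add: scaleR_poly_mapping_def)
qed

lemma single_minus_eq_iff:
  assumes "lk m i > 0"
  shows "m - sg i 1 = (n :: 'n \<Rightarrow>\<^sub>0 nat) \<longleftrightarrow> m = n + sg i 1"
proof
  assume *: "m - sg i 1 = n"
  show "m = n + sg i 1"
  proof (rule poly_mapping_eqI)
    fix k show "lk m k = lk (n + sg i 1) k"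
      using assms by (auto simp: *[symmetric] lookup_add lookup_minus lookup_single when_def)
  qed
qed simp

lemma lookup_partial_deriv:
  "lk (partial_deriv i p) n = real (lk n i + 1) * lk p (n + sg i 1)"
proof -
  let ?n = "n + sg i 1"
  have "lk (partial_deriv i p) n =
      (\<Sum>m\<in>Poly_Mapping.keys p. if m = ?n then real (lk m i) * lk p m else 0)"
    unfolding partial_deriv_def lookup_sum
  proof (rule sum.cong)
    fix m
    show "lk (sg (m - sg i 1) (real (lk m i) * lk p m)) n = (if m = ?n then real (lk m i) * lk p m else 0)"
      using single_minus_eq_iff[of m i n]
      by (cases "lk m i = 0") (auto simp: lookup_single when_def lookup_add)
  qed simp
  also have "\<dots> = real (lk ?n i) * lk p ?n"
    by (simp add: sum.delta' sum.delta in_keys_iff)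
  finally show ?thesis by (simp add: lookup_add)
qed

lemma partial_deriv_commute: "partial_deriv i (partial_deriv j p) = partial_deriv j (partial_deriv i p)"
  by (cases "i = j"; intro poly_mapping_eqI)
    (auto simp: lookup_partial_deriv lookup_add lookup_single ac_simps)

lemma partial_deriv_fold_commute:
  "comp_fun_commute (\<lambda>i. partial_deriv i ^^ Poly_Mapping.lookup n i)"
proof
  fix i j :: 'a
  have 1: "partial_deriv i \<circ> (partial_deriv j ^^ k) = (partial_deriv j ^^ k) \<circ> partial_deriv i" for k
    by (induction k) (auto simp: fun_eq_iff partial_deriv_commute[of i j])
  have "(partial_deriv i ^^ l) \<circ> (partial_deriv j ^^ k) = (partial_deriv j ^^ k) \<circ> (partial_deriv i ^^ l)" for k l
    by (induction l) (use 1 in \<open>auto simp: fun_eq_iff\<close>)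
  then show "(partial_deriv j ^^ lk n j) \<circ> (partial_deriv i ^^ lk n i) = (partial_deriv i ^^ lk n i) \<circ> (partial_deriv j ^^ lk n j)"
    by simp
qed

lemma lookup_partial_deriv_power:
  "lk ((partial_deriv i ^^ k) p) m = fact (lk m i + k) / fact (lk m i) * lk p (m + sg i k)"
proof (induction k arbitrary: m)
  case (Suc k)
  have "m + sg i 1 + sg i k = m + sg i (Suc k)"
    by (simp add: single_add[symmetric] add.assoc)
  moreover have "fact (Suc (lk m i)) = real (Suc (lk m i)) * fact (lk m i)" by simp
  ultimately show ?case
    by (simp add: lookup_partial_deriv Suc lookup_add del: of_nat_Suc fact_Suc)
qed simp

lemma lookup_partial_derivs:
  "Poly_Mapping.lookup (partial_derivs n p) m =
    (\<Prod>i\<in>UNIV. fact (lk m i + lk n i) / fact (lk m i)) * lk p (m + n)"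
proof -
  interpret comp_fun_commute "\<lambda>i. partial_deriv i ^^ Poly_Mapping.lookup n i"
    by (rule partial_deriv_fold_commute)
  have "lk (Finite_Set.fold (\<lambda>i. partial_deriv i ^^ lk n i) p A) m =
    (\<Prod>i\<in>A. fact (lk m i + lk n i) / fact (lk m i)) * lk p (m + (\<Sum>i\<in>A. sg i (lk n i)))" if "finite A" for A
    using that
  proof (induction A arbitrary: m)
    case (insert i A)
    have "(\<Prod>j\<in>A. fact (lk (m + sg i (lk n i)) j + lk n j) / fact (lk (m + sg i (lk n i)) j)) =
      (\<Prod>j\<in>A. fact (lk m j + lk n j) / fact (lk m j) :: real)"
      using insert.hyps by (intro prod.cong) (auto simp: lookup_add lookup_single when_def)
    then show ?case
      using insert by (simp add: lookup_partial_deriv_power add.assoc)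
  qed simp
  moreover have "(\<Sum>i\<in>UNIV. sg i (lk n i)) = n"
    by (intro poly_mapping_eqI) (simp add: lookup_sum lookup_single when_def)
  ultimately show ?thesis
    by (simp add: partial_derivs_def)
qed

lemma finite_partial_derivs:
  fixes p :: "'n::finite rpoly"
  shows "finite {n. partial_derivs n p \<noteq> 0}"
proof -
  have "finite {n. \<forall>i. lk n i \<le> lk k i}" for k :: "'n \<Rightarrow>\<^sub>0 nat"
  proof -
    have "finite (PiE UNIV (\<lambda>i. {..lk k i}))" by (intro finite_PiE) auto
    then have "finite (lk -` (PiE UNIV (\<lambda>i. {..lk k i})))"
      by (rule finite_vimageI) (simp add: inj_on_def)
    moreover have "lk -` (PiE UNIV (\<lambda>i. {..lk k i})) = {n. \<forall>i. lk n i \<le> lk k i}"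
      by (auto simp: PiE_def Pi_def)
    ultimately show ?thesis by simp
  qed
  then have "finite (\<Union>k\<in>Poly_Mapping.keys p. {n. \<forall>i. lk n i \<le> lk k i})" by simp
  moreover have "{n. partial_derivs n p \<noteq> 0} \<subseteq> \<dots>"
  proof safe
    fix n assume "partial_derivs n p \<noteq> 0"
    then obtain m where "lk (partial_derivs n p) m \<noteq> 0"
      by (metis lookup_zero poly_mapping_eqI)
    then have "m + n \<in> Poly_Mapping.keys p" by (auto simp: lookup_partial_derivs in_keys_iff)
    then show "n \<in> (\<Union>k\<in>Poly_Mapping.keys p. {n. \<forall>i. lk n i \<le> lk k i})"
      by (auto simp: lookup_add intro!: bexI[of _ "m + n"])
  qed
  ultimately show ?thesis by (rule finite_subset[rotated])
qed

lemma lookup_Sum_any_derivs: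
  "lk (Sum_any (\<lambda>n. a n *\<^sub>R partial_derivs n p)) m = Sum_any (\<lambda>n. a n * lk (partial_derivs n p) m)"
proof -
  let ?S = "{n. partial_derivs n p \<noteq> 0}"
  have "Sum_any (\<lambda>n. a n *\<^sub>R partial_derivs n p) = (\<Sum>n\<in>?S. a n *\<^sub>R partial_derivs n p)"
    by (intro Sum_any.expand_superset finite_partial_derivs) auto
  moreover have "Sum_any (\<lambda>n. a n * lk (partial_derivs n p) m) = (\<Sum>n\<in>?S. a n * lk (partial_derivs n p) m)"
    by (intro Sum_any.expand_superset finite_partial_derivs) auto
  ultimately show ?thesis by (simp add: lookup_sum lookup_scaleR_rpoly)
qed

lemma lookup_Sum_any_derivs_0:
  "lk (Sum_any (\<lambda>n. a n *\<^sub>R partial_derivs n (sg k 1))) 0 = a k * (\<Prod>i\<in>UNIV. fact (lk k i))"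
proof -
  have "(\<lambda>n. a n * lk (partial_derivs n (sg k 1)) 0) =
    (\<lambda>n. if n = k then a n * (\<Prod>i\<in>UNIV. fact (lk n i)) else 0)"
    by (auto simp: lookup_partial_derivs lookup_single when_def fun_eq_iff)
  then show ?thesis
    by (simp only: lookup_Sum_any_derivs Sum_any.delta)
qed

lemma has_indicator_coeff:
  assumes "has_indicator L a"
  shows "a k = lk (L (sg k 1)) 0 / (\<Prod>i\<in>UNIV. fact (lk k i))"
  using assms by (simp add: has_indicator_def lookup_Sum_any_derivs_0)


lemma rpoly_monom_sum: "(p::'n rpoly) = (\<Sum>k\<in>Poly_Mapping.keys p. lk p k *\<^sub>R sg k 1)"
  by (intro poly_mapping_eqI)
    (simp add: lookup_sum lookup_scaleR_rpoly lookup_single when_def in_keys_iff if_distrib cong: if_cong)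

lemma linear_eq_rpoly:
  assumes "linear A" "linear B" "\<And>k. A (sg k 1) = B (sg k 1)"
  shows "A (p::'n rpoly) = B p"
proof -
  have "A (\<Sum>k\<in>Poly_Mapping.keys p. lk p k *\<^sub>R sg k 1) = B (\<Sum>k\<in>Poly_Mapping.keys p. lk p k *\<^sub>R sg k 1)"
    by (simp add: linear_sum[OF assms(1)] linear_sum[OF assms(2)] linear_cmul[OF assms(1)] linear_cmul[OF assms(2)] assms(3))
  then show ?thesis by (simp add: rpoly_monom_sum[symmetric])
qed

lemma Const_mult: "Const c * p = c *\<^sub>R p"
proof -
  have "lk (sg 0 c * p) n = c * lk p n" for n
  proof -
    have "sg 0 c * p = Poly_Mapping.map ((*) c) p" by (simp add: mult_map_scale_conv_mult)
    then show ?thesis by (simp add: Poly_Mapping.map.rep_eq when_def)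
  qed
  then show ?thesis unfolding Const_def
    by (intro poly_mapping_eqI) (simp add: lookup_scaleR_rpoly)
qed

lemma scaleR_mult_rpoly: "(c *\<^sub>R p) * q = c *\<^sub>R (p * (q :: 'n rpoly))"
  unfolding Const_mult[symmetric] by (rule mult.assoc)

lemma poly_subst_superset:
  assumes "finite K" "Poly_Mapping.keys p \<subseteq> K"
  shows "poly_subst g p = (\<Sum>m\<in>K. lk p m *\<^sub>R (\<Prod>i\<in>UNIV. g i ^ lk m i))"
  unfolding poly_subst_def Const_mult
  by (rule sum.mono_neutral_left) (use assms in \<open>auto simp: in_keys_iff\<close>)

lemma linear_poly_subst: "linear (poly_subst g)"
proof (rule linearI)
  fix p q :: "'a rpoly"
  let ?K = "Poly_Mapping.keys p \<union> Poly_Mapping.keys q"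
  have "Poly_Mapping.keys (p + q) \<subseteq> ?K" by (rule keys_add)
  then show "poly_subst g (p + q) = poly_subst g p + poly_subst g q"
    by (simp add: poly_subst_superset[of ?K] lookup_add scaleR_add_left sum.distrib)
next
  fix c and p :: "'a rpoly"
  have "Poly_Mapping.keys (c *\<^sub>R p) \<subseteq> Poly_Mapping.keys p" by (auto simp: in_keys_iff lookup_scaleR_rpoly)
  then show "poly_subst g (c *\<^sub>R p) = c *\<^sub>R poly_subst g p"
    by (simp add: poly_subst_superset[of "Poly_Mapping.keys p"] lookup_scaleR_rpoly scaleR_sum_right)
qed

lemma linear_shift: "linear (shift v)"
  by (simp add: shift_def linear_poly_subst)

lemma poly_subst_monom: "poly_subst g (sg k 1) = (\<Prod>i\<in>UNIV. g i ^ lk k i)"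
  by (simp add: poly_subst_def Const_def)

lemma Var_power: "Var i ^ n = sg (sg i n) 1"
  by (induction n) (simp_all add: Var_def mult_single single_add[symmetric])

lemma Const_power: "Const c ^ n = Const (c ^ n)"
  by (induction n) (simp_all add: Const_def mult_single)

lemma Var_Const_power:
  "(Var i + Const c) ^ n = (\<Sum>j\<le>n. (real (n choose j) * c ^ (n - j)) *\<^sub>R sg (sg i j) 1)"
  unfolding binomial_ring
proof (rule sum.cong)
  fix j
  have *: "of_nat (n choose j) = Const (real (n choose j))"
    by (simp add: Const_def)
  show "of_nat (n choose j) * Var i ^ j * Const c ^ (n - j) = (real (n choose j) * c ^ (n - j)) *\<^sub>R sg (sg i j) 1"
    unfolding * Const_power Var_power by (simp add: Const_mult mult.commute[of _ "Const _"] ac_simps)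
qed simp

lemma lookup_monom_mult:
  fixes Q :: "'n rpoly"
  shows "lk (sg s 1 * Q) m = (if \<forall>i. lk s i \<le> lk m i then lk Q (m - s) else 0)"
proof -
  have "lk (sg s 1 * Q) m = Sum_any (\<lambda>q. lk Q q when m = s + q)"
    by (simp add: lookup_mult lookup_single when_mult)
  also have "\<dots> = (if \<forall>i. lk s i \<le> lk m i then lk Q (m - s) else 0)"
  proof (cases "\<forall>i. lk s i \<le> lk m i")
    case True
    have "(m = s + q) = (q = m - s)" for q
    proof
      assume "q = m - s"
      then show "m = s + q" using True by (intro poly_mapping_eqI) (simp add: lookup_add lookup_minus)
    qed simp
    then show ?thesis using True by simp
  next
    case False
    then have "\<not> (m = s + q)" for q by (auto simp: lookup_add)
    then show ?thesis using False by auto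
  qed
  finally show ?thesis .
qed

lemma lookup_shift_monom_aux:
  assumes "finite A"
  shows "lk (\<Prod>i\<in>A. (Var i + Const (v i)) ^ lk k i) m =
    (if \<forall>i. i \<notin> A \<longrightarrow> lk m i = 0 then \<Prod>i\<in>A. real (lk k i choose lk m i) * v i ^ (lk k i - lk m i) else 0)"
  using assms
proof (induction A arbitrary: m)
  case empty
  have "m = 0 \<longleftrightarrow> (\<forall>i. lk m i = 0)" by (metis lookup_zero poly_mapping_eqI)
  then show ?case by (simp add: lookup_one when_def)
next
  case (insert i A)
  let ?Q = "\<Prod>i\<in>A. (Var i + Const (v i)) ^ lk k i"
  let ?P = "\<lambda>m. \<forall>i. i \<notin> A \<longrightarrow> lk m i = 0"
  let ?R = "\<lambda>m. (\<Prod>i\<in>A. real (lk k i choose lk m i) * v i ^ (lk k i - lk m i))"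
  have "lk (\<Prod>i\<in>insert i A. (Var i + Const (v i)) ^ lk k i) m =
    (\<Sum>j\<le>lk k i. real (lk k i choose j) * v i ^ (lk k i - j) *
       (if j \<le> lk m i then lk ?Q (m - sg i j) else 0))"
  proof -
    have "(\<forall>l. lk (sg i j) l \<le> lk m l) = (j \<le> lk m i)" for j
      by (auto simp: lookup_single when_def)
    then show ?thesis
      unfolding prod.insert[OF insert.hyps]
      by (subst Var_Const_power)
        (simp add: sum_distrib_right lookup_sum lookup_scaleR_rpoly lookup_monom_mult scaleR_mult_rpoly)
  qed
  also have "\<dots> = (\<Sum>j\<le>lk k i. if j = lk m i then
      real (lk k i choose j) * v i ^ (lk k i - j) * (if \<forall>l. l \<notin> insert i A \<longrightarrow> lk m l = 0 then ?R m else 0) else 0)"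
  proof (rule sum.cong)
    fix j
    have 1: "j = lk m i" if "?P (m - sg i j)" "j \<le> lk m i"
      using that insert.hyps by (auto simp: lookup_minus dest!: spec[of _ i])
    have 2: "?P (m - sg i (lk m i)) = (\<forall>l. l \<notin> insert i A \<longrightarrow> lk m l = 0)"
      by (auto simp: lookup_minus lookup_single when_def)
    have 3: "?R (m - sg i j) = ?R m"
      using insert.hyps by (intro prod.cong) (auto simp: lookup_minus lookup_single when_def)
    show "real (lk k i choose j) * v i ^ (lk k i - j) * (if j \<le> lk m i then lk ?Q (m - sg i j) else 0) =
      (if j = lk m i then real (lk k i choose j) * v i ^ (lk k i - j) * (if \<forall>l. l \<notin> insert i A \<longrightarrow> lk m l = 0 then ?R m else 0) else 0)"
      unfolding insert.IH 3 using 1 2 by auto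
  qed simp
  also have "\<dots> = (if \<forall>l. l \<notin> insert i A \<longrightarrow> lk m l = 0 then
     (\<Prod>i\<in>insert i A. real (lk k i choose lk m i) * v i ^ (lk k i - lk m i)) else 0)"
    using insert.hyps by (auto simp: sum.delta)
  finally show ?case .
qed

lemma lookup_shift_monom:
  "lk (shift v (sg k 1)) m = (\<Prod>i\<in>UNIV. real (lk k i choose lk m i) * (v $ i) ^ (lk k i - lk m i))"
  unfolding shift_def poly_subst_monom by (subst lookup_shift_monom_aux) auto

lemma linear_partial_deriv: "linear (partial_deriv i)"
  by (rule linearI; rule poly_mapping_eqI) (auto simp: lookup_partial_deriv lookup_add lookup_scaleR_rpoly algebra_simps)

lemma partial_deriv_monom: "partial_deriv i (sg k 1) = real (lk k i) *\<^sub>R sg (k - sg i 1) 1"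
  unfolding partial_deriv_def by (auto intro!: poly_mapping_eqI simp: lookup_scaleR_rpoly lookup_single when_def)

lemma partial_deriv_shift: "partial_deriv i (shift v p) = shift v (partial_deriv i p)"
proof -
  have "linear (partial_deriv i \<circ> shift v)" "linear (shift v \<circ> partial_deriv i)"
    by (intro linear_compose linear_shift linear_partial_deriv)+
  moreover have "(partial_deriv i \<circ> shift v) (sg k 1) = (shift v \<circ> partial_deriv i) (sg k 1)" for k
  proof (rule poly_mapping_eqI)
    fix m
    let ?f = "\<lambda>k m j. real (lk k j choose lk m j) * (v $ j) ^ (lk k j - lk m j)"
    have 1: "real (lk m i + 1) * ?f k (m + sg i 1) i = real (lk k i) * ?f (k - sg i 1) m i"
    proof (cases "lk k i")
      case (Suc l)
      have "real (Suc (lk m i)) * real (Suc l choose Suc (lk m i)) = real (Suc l) * real (l choose lk m i)"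
        by (metis Suc_times_binomial_eq mult.commute of_nat_mult)
      then show ?thesis using Suc by (simp add: lookup_add lookup_minus)
    qed (simp add: lookup_add)
    have 2: "(\<Prod>j\<in>UNIV - {i}. ?f k (m + sg i 1) j) = (\<Prod>j\<in>UNIV - {i}. ?f (k - sg i 1) m j)"
      by (rule prod.cong) (auto simp: lookup_add lookup_minus lookup_single when_def)
    have 3: "prod g UNIV = g i * prod g (UNIV - {i})" for g :: "'a \<Rightarrow> real"
      by (rule prod.remove) auto
    show "lk ((partial_deriv i \<circ> shift v) (sg k 1)) m = lk ((shift v \<circ> partial_deriv i) (sg k 1)) m"
      unfolding o_def lookup_partial_deriv lookup_shift_monom partial_deriv_monom linear_cmul[OF linear_shift]
        lookup_scaleR_rpoly 3 2
      unfolding mult.assoc[symmetric] 1[unfolded mult.assoc[symmetric]] by (rule refl)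
  qed
  ultimately show ?thesis
    using linear_eq_rpoly[of "partial_deriv i \<circ> shift v" "shift v \<circ> partial_deriv i" p] by simp
qed

lemma partial_derivs_shift: "partial_derivs n (shift v p) = shift v (partial_derivs n p)"
proof -
  interpret comp_fun_commute "\<lambda>i. partial_deriv i ^^ Poly_Mapping.lookup n i"
    by (rule partial_deriv_fold_commute)
  have *: "(partial_deriv i ^^ k) (shift v p) = shift v ((partial_deriv i ^^ k) p)" for i k p
    by (induction k) (auto simp: partial_deriv_shift)
  have "Finite_Set.fold (\<lambda>i. partial_deriv i ^^ lk n i) (shift v p) A =
    shift v (Finite_Set.fold (\<lambda>i. partial_deriv i ^^ lk n i) p A)" if "finite A" for A
    using that by induction (auto simp: *)
  then show ?thesis by (simp add: partial_derivs_def)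
qed

lemma Sum_any_derivs_shift:
  "Sum_any (\<lambda>n. a n *\<^sub>R partial_derivs n (shift v p)) = shift v (Sum_any (\<lambda>n. a n *\<^sub>R partial_derivs n p))"
proof -
  let ?S = "{n. partial_derivs n p \<noteq> 0}"
  have "Sum_any (\<lambda>n. a n *\<^sub>R partial_derivs n p) = (\<Sum>n\<in>?S. a n *\<^sub>R partial_derivs n p)"
    by (intro Sum_any.expand_superset finite_partial_derivs) auto
  moreover have "Sum_any (\<lambda>n. a n *\<^sub>R partial_derivs n (shift v p)) = (\<Sum>n\<in>?S. a n *\<^sub>R partial_derivs n (shift v p))"
    by (intro Sum_any.expand_superset finite_partial_derivs) (auto simp: partial_derivs_shift linear_0[OF linear_shift])
  ultimately show ?thesis
    by (simp add: linear_sum[OF linear_shift] linear_cmul[OF linear_shift] partial_derivs_shift)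
qed

lemma linear_Sum_any_derivs: "linear (\<lambda>p. Sum_any (\<lambda>n. a n *\<^sub>R partial_derivs n p))"
proof (rule linearI; rule poly_mapping_eqI)
  have fin: "finite {n. a n * lk (partial_derivs n p) m \<noteq> 0}" for p m
    by (rule finite_subset[OF _ finite_partial_derivs[of p]]) auto
  fix p q :: "'a rpoly" and m c
  have "Sum_any (\<lambda>n. a n * lk (partial_derivs n (p + q)) m) =
    Sum_any (\<lambda>n. a n * lk (partial_derivs n p) m + a n * lk (partial_derivs n q) m)"
    by (simp add: lookup_partial_derivs lookup_add algebra_simps)
  then show "lk (Sum_any (\<lambda>n. a n *\<^sub>R partial_derivs n (p + q))) m =
    lk (Sum_any (\<lambda>n. a n *\<^sub>R partial_derivs n p) + Sum_any (\<lambda>n. a n *\<^sub>R partial_derivs n q)) m"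
    by (simp only: lookup_add lookup_Sum_any_derivs Sum_any.distrib[OF fin fin])
  have "Sum_any (\<lambda>n. a n * lk (partial_derivs n (c *\<^sub>R p)) m) =
    Sum_any (\<lambda>n. c * (a n * lk (partial_derivs n p) m))"
    by (simp add: lookup_partial_derivs lookup_scaleR_rpoly algebra_simps)
  then show "lk (Sum_any (\<lambda>n. a n *\<^sub>R partial_derivs n (c *\<^sub>R p))) m =
    lk (c *\<^sub>R Sum_any (\<lambda>n. a n *\<^sub>R partial_derivs n p)) m"
    by (simp only: lookup_scaleR_rpoly lookup_Sum_any_derivs Sum_any_right_distrib[OF fin])
qed

lemma multivar_identity:
  fixes c :: "('n::finite \<Rightarrow>\<^sub>0 nat) \<Rightarrow> real"
  assumes "finite A" "finite K" "\<And>v::'n\<Rightarrow>real. (\<Sum>k\<in>K. c k * (\<Prod>i\<in>A. v i ^ lk k i)) = 0"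
  shows "(\<Sum>k\<in>{k\<in>K. \<forall>i\<in>A. lk k i = lk k0 i}. c k) = 0"
  using assms
proof (induction A arbitrary: K)
  case (insert i A)
  define N where "N = Max (insert (lk k0 i) ((\<lambda>k. lk k i) ` K))"
  have N: "lk k i \<le> N" if "k \<in> K" for k
    unfolding N_def using insert.prems that by (intro Max_ge) auto
  have N0: "lk k0 i \<le> N"
    unfolding N_def using insert.prems by (intro Max_ge) auto
  let ?K = "{k\<in>K. lk k i = lk k0 i}"
  have "(\<Sum>k\<in>?K. c k * (\<Prod>j\<in>A. v j ^ lk k j)) = 0" for v
  proof -
    let ?b = "\<lambda>e. \<Sum>k\<in>{k\<in>K. lk k i = e}. c k * (\<Prod>j\<in>A. v j ^ lk k j)"
    have "(\<Sum>e\<le>N. ?b e * t ^ e) = 0" for t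
    proof -
      have "(\<Sum>e\<le>N. ?b e * t ^ e) = (\<Sum>e\<le>N. \<Sum>k\<in>{k\<in>K. lk k i = e}. c k * (\<Prod>j\<in>insert i A. (v(i := t)) j ^ lk k j))"
      proof (rule sum.cong)
        fix e
        have "(\<Prod>j\<in>A. v j ^ lk k j) = (\<Prod>j\<in>A. (if j = i then t else v j) ^ lk k j)" for k
          using insert.hyps by (intro prod.cong) auto
        then show "?b e * t ^ e = (\<Sum>k\<in>{k\<in>K. lk k i = e}. c k * (\<Prod>j\<in>insert i A. (v(i := t)) j ^ lk k j))"
          using insert.hyps by (simp add: sum_distrib_left mult.commute mult.left_commute)
      qed simp
      also have "\<dots> = (\<Sum>k\<in>K. c k * (\<Prod>j\<in>insert i A. (v(i := t)) j ^ lk k j))"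
        by (rule sum.group) (use insert.prems N in auto)
      finally show ?thesis using insert.prems by simp
    qed
    from zero_polynom_imp_zero_coeffs[OF this N0] show ?thesis .
  qed
  from insert.IH[OF _ this] insert.prems
  have "(\<Sum>k\<in>{k\<in>?K. \<forall>i\<in>A. lk k i = lk k0 i}. c k) = 0" by simp
  moreover have "{k\<in>?K. \<forall>i\<in>A. lk k i = lk k0 i} = {k\<in>K. \<forall>j\<in>insert i A. lk k j = lk k0 j}" by auto
  ultimately show ?case by simp
qed simp

lemma rpoly_eqI:
  fixes p q :: "'n::finite rpoly"
  assumes "\<And>v. lk (shift v p) 0 = lk (shift v q) 0"
  shows "p = q"
proof -
  let ?r = "p - q"
  have "(\<Sum>k\<in>Poly_Mapping.keys ?r. lk ?r k * (\<Prod>i\<in>UNIV. v i ^ lk k i)) = 0" for v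
  proof -
    let ?v = "\<chi> i. v i"
    have "shift ?v ?r = (\<Sum>k\<in>Poly_Mapping.keys ?r. lk ?r k *\<^sub>R shift ?v (sg k 1))"
      by (subst rpoly_monom_sum) (simp only: linear_sum[OF linear_shift] linear_cmul[OF linear_shift])
    then have "lk (shift ?v ?r) 0 = (\<Sum>k\<in>Poly_Mapping.keys ?r. lk ?r k * (\<Prod>i\<in>UNIV. v i ^ lk k i))"
      by (simp add: lookup_sum lookup_scaleR_rpoly lookup_shift_monom)
    moreover have "lk (shift ?v ?r) 0 = 0"
      using assms by (simp add: linear_diff[OF linear_shift] lookup_minus)
    ultimately show ?thesis by simp
  qed
  then have "(\<Sum>k\<in>{k\<in>Poly_Mapping.keys ?r. \<forall>i\<in>UNIV. lk k i = lk k0 i}. lk ?r k) = 0" for k0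
    by (rule multivar_identity[rotated 2]) auto
  moreover have "(\<forall>i\<in>UNIV. lk k i = lk k0 i) \<longleftrightarrow> k = k0" for k k0 :: "'n \<Rightarrow>\<^sub>0 nat"
    by (simp add: poly_mapping_eq_iff fun_eq_iff)
  then have "{k\<in>Poly_Mapping.keys ?r. \<forall>i\<in>UNIV. lk k i = lk k0 i} = (if lk ?r k0 = 0 then {} else {k0})" for k0
    by (auto simp del: ball_UNIV simp: in_keys_iff)
  ultimately have "sum (lk ?r) (if lk ?r k0 = 0 then {} else {k0}) = 0" for k0
    by (simp only:)
  note * = this
  have "lk ?r k0 = 0" for k0
    using *[of k0] by (simp split: if_splits)
  then have "?r = 0" by (intro poly_mapping_eqI) simp
  then show ?thesis by simp
qed

lemma ex1_has_indicator:
  assumes "shift_invariant L"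
  shows "\<exists>!a. has_indicator L a"
proof (rule ex_ex1I)
  fix a b assume "has_indicator L a" "has_indicator L b"
  then show "a = b" by (auto simp: fun_eq_iff has_indicator_coeff)
next
  define a where "a = (\<lambda>k. lk (L (sg k 1)) 0 / (\<Prod>i\<in>UNIV. fact (lk k i)))"
  define S where "S = (\<lambda>p. Sum_any (\<lambda>n. a n *\<^sub>R partial_derivs n p))"
  have L: "linear L" "\<And>v p. L (shift v p) = shift v (L p)"
    using assms by (auto simp: shift_invariant_def fun_eq_iff)
  have S: "linear S" "\<And>v p. S (shift v p) = shift v (S p)"
    unfolding S_def by (simp_all add: Sum_any_derivs_shift linear_Sum_any_derivs)
  have 0: "lk (S p) 0 = lk (L p) 0" for p
  proof -
    have "linear (\<lambda>p. Const (lk (S p) 0))" "linear (\<lambda>p. Const (lk (L p) 0))"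
      using S L by (auto intro!: linearI poly_mapping_eqI simp: linear_iff lookup_add lookup_scaleR_rpoly Const_def lookup_single when_def)
    moreover have "Const (lk (S (sg k 1)) 0) = Const (lk (L (sg k 1)) 0)" for k
      unfolding S_def lookup_Sum_any_derivs_0 by (simp add: a_def)
    ultimately have "Const (lk (S p) 0) = Const (lk (L p) 0)"
      by (rule linear_eq_rpoly)
    then show ?thesis by (metis Const_def lookup_single_eq)
  qed
  have "S p = L p" for p
    by (rule rpoly_eqI) (simp add: 0 L(2)[symmetric] S(2)[symmetric])
  then have "has_indicator L a" by (simp add: has_indicator_def S_def)
  then show "\<exists>a. has_indicator L a" by blast
qed

end

end

theory Submission
  imports Defs
begin

text \<open>
  An operator with indicator \<open>f\<close> sends \<open>x\<^sub>j\<close> to \<open>f(0) x\<^sub>j\<close> plus the coefficient of \<open>x\<^sub>j\<close> in \<open>f\<close>,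
  since all other derivatives of \<open>x\<^sub>j\<close> vanish. So \<open>\<DD>\<^sub>i\<close> sends a linear form \<open>p\<close> with coefficient
  vector \<open>a\<close> to \<open>(J\<^sub>f a)\<^sub>i + f\<^sub>i(0) p\<close>. This is constant for some \<open>p \<noteq> 0\<close> iff \<open>f\<^sub>i(0) = 0\<close>, and then
  the constants are not all zero for any \<open>a \<noteq> 0\<close> iff \<open>J\<^sub>f\<close> has trivial kernel.
\<close>

lemma single_1_neq_0: "Poly_Mapping.single i (Suc 0) \<noteq> (0 :: 'n \<Rightarrow>\<^sub>0 nat)"
proof
  assume "Poly_Mapping.single i (Suc 0) = 0"
  then have "Poly_Mapping.lookup (Poly_Mapping.single i (Suc 0)) i = 0"
    by (simp only: lookup_zero)
  then show False by simp
qed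

lemma single_1_eq_iff:
  "Poly_Mapping.single i (Suc 0) = (Poly_Mapping.single j (Suc 0) :: 'n \<Rightarrow>\<^sub>0 nat) \<longleftrightarrow> i = j"
proof
  assume "Poly_Mapping.single i (Suc 0) = Poly_Mapping.single j (Suc 0)"
  then have "Poly_Mapping.lookup (Poly_Mapping.single j (Suc 0)) i = Suc 0"
    by (metis lookup_single_eq)
  then show "i = j"
    by (auto simp: lookup_single when_def split: if_splits)
qed simp

text \<open>At \<open>j\<close> the two exponents sum to 1, so one of them is 0 there, and that
  vector then vanishes everywhere. By \<open>lookup_partial_derivs\<close>, the coefficient of
  \<open>partial_derivs n p\<close> at \<open>m\<close> comes from that of \<open>p\<close> at
  \<open>m + n\<close>, so this splitting decides which derivatives of a variable survive.\<close>

lemma add_eq_single_1_iff: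
  fixes m n :: "'n \<Rightarrow>\<^sub>0 nat"
  shows "m + n = Poly_Mapping.single j 1 \<longleftrightarrow>
    m = 0 \<and> n = Poly_Mapping.single j 1 \<or> m = Poly_Mapping.single j 1 \<and> n = 0"
proof
  assume *: "m + n = Poly_Mapping.single j 1"
  have lk: "Poly_Mapping.lookup m k + Poly_Mapping.lookup n k = (if k = j then 1 else 0)" for k
    by (simp add: lookup_add[symmetric] * lookup_single when_def)
  show "m = 0 \<and> n = Poly_Mapping.single j 1 \<or> m = Poly_Mapping.single j 1 \<and> n = 0"
  proof (cases "Poly_Mapping.lookup m j = 0")
    case True
    have "Poly_Mapping.lookup m k = 0" for k
      using lk[of k] True by (cases "k = j") auto
    then have "m = 0" by (intro poly_mapping_eqI) simp
    then show ?thesis using * by simp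
  next
    case False
    have "Poly_Mapping.lookup n k = 0" for k
      using lk[of k] False by (cases "k = j") auto
    then have "n = 0" by (intro poly_mapping_eqI) simp
    then show ?thesis using * by simp
  qed
qed auto

lemma partial_derivs_Var:
  "partial_derivs n (Var j) =
    (if n = 0 then Var j else if n = Poly_Mapping.single j 1 then Const 1 else 0)"
proof (rule poly_mapping_eqI)
  fix m
  \<comment> \<open>This is the factor from \<open>lookup_partial_derivs\<close> for
    \<open>m = 0\<close> and \<open>n\<close> the exponent of \<open>Var j\<close>; it is 1 because
    0! = 1! = 1.\<close>
  have "(\<Prod>i\<in>UNIV. fact (Poly_Mapping.lookup (Poly_Mapping.single j 1) i)) = (1::real)"
    by (rule prod.neutral) (simp add: lookup_single when_def)
  then show "Poly_Mapping.lookup (partial_derivs n (Var j)) m = Poly_Mapping.lookup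
      (if n = 0 then Var j else if n = Poly_Mapping.single j 1 then Const 1 else 0) m"
    using add_eq_single_1_iff[of m n j] single_1_neq_0[of j]
    by (auto simp: lookup_partial_derivs Var_def Const_def lookup_single lookup_one when_def)
qed

lemma has_indicator_Var:
  assumes "has_indicator L f"
  shows "L (Var j) = f 0 *\<^sub>R Var j + Const (f (Poly_Mapping.single j 1))"
proof -
  let ?s = "Poly_Mapping.single j 1"
  have "L (Var j) = Sum_any (\<lambda>n. f n *\<^sub>R partial_derivs n (Var j))"
    using assms by (simp add: has_indicator_def)
  also have "\<dots> = (\<Sum>n\<in>{0, ?s}. f n *\<^sub>R partial_derivs n (Var j))"
    by (rule Sum_any.expand_superset) (auto simp: partial_derivs_Var)
  also have "\<dots> = f 0 *\<^sub>R Var j + f ?s *\<^sub>R Const 1"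
    using single_1_neq_0[of j] by (simp add: partial_derivs_Var eq_commute[of 0])
  also have "f ?s *\<^sub>R Const 1 = Const (f ?s)"
    by (intro poly_mapping_eqI) (simp add: lookup_scaleR_rpoly Const_def lookup_single lookup_one when_def)
  finally show ?thesis .
qed

lemma lookup_linear_form:
  "Poly_Mapping.lookup (\<Sum>j\<in>(UNIV :: 'n::finite set). a j *\<^sub>R Var j) (Poly_Mapping.single i 1) = a i"
  by (simp add: lookup_sum lookup_scaleR_rpoly Var_def lookup_single when_def single_1_eq_iff
      if_distrib cong: if_cong)

text \<open>Lets the quantifier over nonzero linear forms in \<open>delta_system\<close> range over
  nonzero vectors instead, as the kernel criterion for \<open>det\<close> requires.\<close>

lemma linear_form_eq_0_iff:
  fixes a :: "real ^ 'n"
  shows "(\<Sum>j\<in>UNIV. (a $ j) *\<^sub>R Var j) = (0 :: 'n::finite rpoly) \<longleftrightarrow> a = 0"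
proof
  assume "(\<Sum>j\<in>UNIV. (a $ j) *\<^sub>R Var j) = (0 :: 'n rpoly)"
  then have "a $ i = 0" for i
    using lookup_linear_form[of "\<lambda>j. a $ j" i] by simp
  then show "a = 0" by (simp add: vec_eq_iff)
qed simp

lemma indicator_linear_form:
  fixes L :: "'n::finite rpoly \<Rightarrow> 'n rpoly" and a :: "real ^ 'n"
  assumes "linear L" "has_indicator L f"
  shows "L (\<Sum>j\<in>UNIV. (a $ j) *\<^sub>R Var j) =
    f 0 *\<^sub>R (\<Sum>j\<in>UNIV. (a $ j) *\<^sub>R Var j) + Const (\<Sum>j\<in>UNIV. f (Poly_Mapping.single j 1) * a $ j)"
proof -
  have Const: "Const (\<Sum>j\<in>UNIV. f (Poly_Mapping.single j 1) * a $ j) =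
      (\<Sum>j\<in>UNIV. (a $ j) *\<^sub>R Const (f (Poly_Mapping.single j 1)))"
    by (intro poly_mapping_eqI)
      (simp add: lookup_sum lookup_scaleR_rpoly Const_def lookup_single when_def mult.commute)
  show ?thesis
    unfolding Const
    by (simp add: linear_sum[OF assms(1)] linear_cmul[OF assms(1)] has_indicator_Var[OF assms(2)]
        scaleR_right_distrib sum.distrib scaleR_sum_right mult.commute)
qed

theorem theorem1:
  fixes D :: "'n::finite \<Rightarrow> 'n rpoly \<Rightarrow> 'n rpoly"
    and f :: "'n \<Rightarrow> 'n rfps"
  assumes "\<And>i. shift_invariant (D i)"
    and "\<And>i. f i = indicator_fps (D i)"
  shows "delta_system D \<longleftrightarrow> det (jacobian_at_0 f) \<noteq> 0 \<and> (\<forall>i. rfps_const_term (f i) = 0)"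
proof -
  let ?p = "\<lambda>a :: real ^ 'n. (\<Sum>j\<in>UNIV. (a $ j) *\<^sub>R Var j) :: 'n rpoly"
  let ?J = "jacobian_at_0 f"
  have ind: "has_indicator (D i) (f i)" for i
    using theI'[OF ex1_has_indicator[OF assms(1)]] by (simp add: assms(2) indicator_fps_def)
  have lin: "linear (D i)" for i
    using assms(1) by (simp add: shift_invariant_def)
  \<comment> \<open>The factor that \<open>rfps_deriv\<close> puts on the constant term is 0 + 1 =
    1, so the Jacobian entries are exactly the degree-one coefficients.\<close>
  have J: "(\<Sum>j\<in>UNIV. f i (Poly_Mapping.single j 1) * a $ j) = (?J *v a) $ i" for a i
    by (simp add: jacobian_at_0_def matrix_vector_mult_def rfps_const_term_def rfps_deriv_def)
  have D: "D i (?p a) = f i 0 *\<^sub>R ?p a + Const ((?J *v a) $ i)" for i a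
    by (simp only: indicator_linear_form[OF lin ind] J)
  have det: "det ?J \<noteq> 0 \<longleftrightarrow> (\<forall>a. a \<noteq> 0 \<longrightarrow> ?J *v a \<noteq> 0)"
    unfolding invertible_det_nz[symmetric] invertible_left_inverse matrix_left_invertible_ker by blast
  have delta: "delta_system D \<longleftrightarrow>
      (\<forall>a. a \<noteq> 0 \<longrightarrow> (\<exists>c. (\<forall>i. D i (?p a) = Const (c $ i)) \<and> c \<noteq> 0))"
    by (simp add: delta_system_def assms(1) linear_form_eq_0_iff vec_eq_iff)
  have lookup_Const: "Poly_Mapping.lookup (Const c :: 'n rpoly) (Poly_Mapping.single j 1) = 0" for c j
    using single_1_neq_0[of j] by (simp add: Const_def lookup_single when_def eq_commute[of 0])
  have Const_inj: "Const c = Const d \<longleftrightarrow> c = d" for c d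
    unfolding Const_def by (metis lookup_single_eq)
  show ?thesis
  proof
    assume *: "delta_system D"
    have f0: "f i 0 = 0" for i
    proof -
      \<comment> \<open>Test on the form x_i: the x_i-coefficient of its image under
        \<open>D i\<close> is \<open>f i 0\<close>, whereas a constant has none.\<close>
      have "axis i 1 \<noteq> (0 :: real ^ 'n)"
        by simp
      then obtain c where "D i (?p (axis i 1)) = Const c"
        using * unfolding delta by blast
      then have "Poly_Mapping.lookup (D i (?p (axis i 1))) (Poly_Mapping.single i 1) = 0"
        by (simp only: lookup_Const)
      then show ?thesis
        unfolding D lookup_add lookup_scaleR_rpoly lookup_Const lookup_linear_form by simp
    qed
    have "?J *v a \<noteq> 0" if a: "a \<noteq> 0" for a
    proof -
      obtain c where "\<forall>i. D i (?p a) = Const (c $ i)" "c \<noteq> 0"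
        using * a unfolding delta by blast
      \<comment> \<open>With \<open>f0\<close>, injectivity of \<open>Const\<close> forces
        \<open>c = ?J *v a\<close>.\<close>
      then show ?thesis
        by (simp add: D f0 Const_inj vec_eq_iff)
    qed
    then show "det ?J \<noteq> 0 \<and> (\<forall>i. rfps_const_term (f i) = 0)"
      by (simp add: det f0 rfps_const_term_def)
  next
    assume *: "det ?J \<noteq> 0 \<and> (\<forall>i. rfps_const_term (f i) = 0)"
    \<comment> \<open>Conversely, \<open>?J *v a\<close> itself serves as the vector of constants,
      and it is nonzero by \<open>det\<close>.\<close>
    then have "D i (?p a) = Const ((?J *v a) $ i)" for i a
      by (simp add: D rfps_const_term_def)
    then show "delta_system D"
      using * unfolding delta det by blast
  qed
qed

end
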